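(* Let $a,b$ be integers with $a-1>b\ge 1$, let $u_\beta=\lim_{n\to\infty}\varphi^n(0)$ be the fixed point of the substitution $\varphi(0)=0^a1$, $\varphi(1)=0^b1$, let $T(w)=0^b1\varphi(w)0^b$, and define $U^{(1)}=0^{a-1}$, $U^{(n)}=T(U^{(n-1)})$, $V^{(1)}=0^b$, $V^{(n)}=T(V^{(n-1)})$ for $n\ge 2$. Then for every integer $n\ge 0$: (i) If $b$ is even and $a$ odd: $\mathcal P(2n)=2$ if $|V^{(2k-1)}|<2n\le|U^{(2k-1)}|$ for some $k\in\mathbb N$, and $\mathcal P(2n)=1$ otherwise; $\mathcal P(2n+1)=3$ if $|V^{(2k)}|<2n+1\le |U^{(2k)}|$ for some $k\in\mathbb N$, and $\mathcal P(2n+1)=2$ otherwise. (ii) If $a$ and $b$ are both even: $\mathcal P(2n)=2$ if $|V^{(2k-1)}|<2n\le|U^{(2k)}|$ for some $k\in\mathbb N$, and $\mathcal P(2n)=1$ otherwise; $\mathcal P(2n+1)=2$ if $2n+1\le |U^{(1)}|=a-1$ or if $|V^{(2k)}|<2n+1\le|U^{(2k+1)}|$ for some $k\in\mathbb N$, and $\mathcal P(2n+1)=1$ otherwise. (iii) If $b$ is odd and $a$ even: $\mathcal P(2n)=2$ if $|V^{(3k-1)}|<2n\le|U^{(3k-1)}|$ for some $k\in\mathbb N$, and $\mathcal P(2n)=1$ otherwise; $\mathcal P(2n+1)=3$ if $|V^{(k)}|<2n+1\le |U^{(k)}|$ for some $k\in\mathbb N$ with $k\not\equiv 2 \pmod 3$,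 and $\mathcal P(2n+1)=2$ otherwise. (iv) If $a$ and $b$ are both odd: $\mathcal P(2n)=1$ if $0\le 2n\le |U^{(1)}|=a-1$, and $\mathcal P(2n)=0$ otherwise; $\mathcal P(2n+1)=2$ if $2n+1\le |V^{(1)}|=b$, $\mathcal P(2n+1)=4$ if $|V^{(k)}|<2n+1\le|U^{(k)}|$ for some $k\ge 2$, and $\mathcal P(2n+1)=3$ otherwise.
   Context: $\mathbb N$ denotes the positive integers, $|w|$ the length of a word $w$. $\mathcal P(m)$ is the number of distinct palindromes (words equal to their reversal) of length $m$ that are factors of $u_\beta$; the empty word is counted as the unique palindrome of length $0$. *)

theory Defs
  imports "HOL-Library.Omega_Words_Fun"
begin

datatype letter = Zero | One

fun subst_letter :: "nat \<Rightarrow> nat \<Rightarrow> letter \<Rightarrow> letter list" where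
  "subst_letter a b Zero = replicate a Zero @ [One]"
| "subst_letter a b One = replicate b Zero @ [One]"

definition subst :: "nat \<Rightarrow> nat \<Rightarrow> letter list \<Rightarrow> letter list" where
  "subst a b w = concat (map (subst_letter a b) w)"

text \<open>Convergence of finite words to an infinite word: every position is eventually
  present and eventually carries the letter of the limit.\<close>

definition word_tendsto :: "(nat \<Rightarrow> 'a list) \<Rightarrow> 'a word \<Rightarrow> bool" where
  "word_tendsto w u \<longleftrightarrow> (\<forall>i. \<forall>\<^sub>F n in sequentially. i < length (w n) \<and> w n ! i = u i)"

definition u_beta :: "nat \<Rightarrow> nat \<Rightarrow> letter word" where
  "u_beta a b = (THE u. word_tendsto (\<lambda>n. (subst a b ^^ n) [Zero]) u)"

definition factor :: "'a list \<Rightarrow> 'a word \<Rightarrow> bool" where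
  "factor w u \<longleftrightarrow> (\<exists>i j. i \<le> j \<and> w = subsequence u i j)"

definition palindrome :: "'a list \<Rightarrow> bool" where
  "palindrome w \<longleftrightarrow> rev w = w"

definition pal_complexity :: "'a word \<Rightarrow> nat \<Rightarrow> nat" where
  "pal_complexity u m = card {w. length w = m \<and> palindrome w \<and> factor w u}"

definition T_map :: "nat \<Rightarrow> nat \<Rightarrow> letter list \<Rightarrow> letter list" where
  "T_map a b w = replicate b Zero @ [One] @ subst a b w @ replicate b Zero"

text \<open>The sequences \<open>U_word\<close> and \<open>V_word\<close> are indexed from 1; the value at index 0 is irrelevant.\<close>

definition U_word :: "nat \<Rightarrow> nat \<Rightarrow> nat \<Rightarrow> letter list" where
  "U_word a b n = (T_map a b ^^ (n - 1)) (replicate (a - 1) Zero)"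

definition V_word :: "nat \<Rightarrow> nat \<Rightarrow> nat \<Rightarrow> letter list" where
  "V_word a b n = (T_map a b ^^ (n - 1)) (replicate b Zero)"

text \<open>The definite description in \<^const>\<open>u_beta\<close> is proper: the limit exists (already for
  \<open>a \<ge> 1\<close>) and is unique.\<close>

lemma word_tendsto_unique:
  assumes "word_tendsto w u" "word_tendsto w v"
  shows "u = v"
proof
  fix i
  have "\<forall>\<^sub>F n in sequentially. u i = v i"
    using assms[unfolded word_tendsto_def, rule_format, of i]
    by eventually_elim simp
  then show "u i = v i" by simp
qed

lemma subst_append: "subst a b (v @ w) = subst a b v @ subst a b w"
  by (simp add: subst_def)

lemma subst_pow_append: "(subst a b ^^ n) (v @ w) = (subst a b ^^ n) v @ (subst a b ^^ n) w"
  by (induction n) (simp_all add: subst_append)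

lemma length_subst_ge: "length w \<le> length (subst a b w)"
proof (induction w)
  case (Cons x w)
  then show ?case by (cases x) (simp_all add: subst_def)
qed (simp add: subst_def)

lemma length_subst_pow_ge: "length w \<le> length ((subst a b ^^ n) w)"
  by (induction n) (auto intro: order_trans length_subst_ge)

lemma subst_pow_Suc_Zero:
  assumes "a \<ge> 1"
  shows "\<exists>v. (subst a b ^^ Suc n) [Zero] = (subst a b ^^ n) [Zero] @ v \<and> v \<noteq> []"
proof -
  obtain a' where a': "a = Suc a'" using assms by (cases a) auto
  define r where "r = replicate a' Zero @ [One]"
  have "subst a b [Zero] = [Zero] @ r" by (simp add: subst_def a' r_def)
  then have "(subst a b ^^ Suc n) [Zero] = (subst a b ^^ n) [Zero] @ (subst a b ^^ n) r"
    using subst_pow_append[of n a b "[Zero]" r] by (simp add: funpow_swap1)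
  moreover have "(subst a b ^^ n) r \<noteq> []"
    using length_subst_pow_ge[of r n a b] by (auto simp: r_def)
  ultimately show ?thesis by blast
qed

lemma word_tendsto_u_beta:
  assumes "a \<ge> 1"
  shows "word_tendsto (\<lambda>n. (subst a b ^^ n) [Zero]) (u_beta a b)"
proof -
  let ?w = "\<lambda>n. (subst a b ^^ n) [Zero]"
  have len: "n < length (?w n)" for n
  proof (induction n)
    case (Suc n)
    obtain v where "?w (Suc n) = ?w n @ v" "v \<noteq> []"
      using subst_pow_Suc_Zero[OF assms] by blast
    then have "length (?w n) < length (?w (Suc n))" by simp
    with Suc show ?case by linarith
  qed simp
  have ext: "?w n ! i = ?w i ! i \<and> i < length (?w n)" if "i \<le> n" for i n
    using that
  proof (induction n rule: dec_induct)
    case base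
    show ?case using len by simp
  next
    case (step n)
    obtain v where v: "?w (Suc n) = ?w n @ v"
      using subst_pow_Suc_Zero[OF assms] by blast
    show ?case unfolding v using step.IH by (simp add: nth_append)
  qed
  have "word_tendsto ?w (\<lambda>i. ?w i ! i)"
    unfolding word_tendsto_def eventually_sequentially using ext by blast
  then have "\<exists>!u. word_tendsto ?w u"
    using word_tendsto_unique[of ?w] by (intro ex_ex1I exI)
  then show ?thesis
    unfolding u_beta_def by (rule theI')
qed

end

theory Submission
  imports Defs "HOL-Library.Sublist"
begin

text \<open>Write \<open>E(p)\<close> for the set of letters \<open>x\<close> such that \<open>x p x\<close> is a factor of
  \<open>u\<^sub>\<beta>\<close>; then \<open>P(m + 2) - P(m)\<close> is the sum of \<open>|E(p)| - 1\<close> over the palindromic factors \<open>p\<close> of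
  length \<open>m\<close>. A palindromic factor containing a \<open>1\<close> has the form \<open>0\<^sup>i 1 \<phi>(v) 0\<^sup>i\<close> with \<open>v\<close> a
  palindrome. If \<open>i \<noteq> b\<close>, the run \<open>0\<^sup>i\<close> determines its continuation, so \<open>|E(p)| = 1\<close>; if \<open>i = b\<close>,
  then \<open>p = T(v)\<close> and \<open>E(p) = E(v)\<close>. Together with the words \<open>0\<^sup>i\<close> this shows that \<open>|E(p)|\<close> is
  \<open>2\<close> for the words \<open>V\<^sup>(\<^sup>k\<^sup>)\<close>, \<open>0\<close> for the words \<open>U\<^sup>(\<^sup>k\<^sup>)\<close> and \<open>1\<close> otherwise. Since
  \<open>|V\<^sup>(\<^sup>k\<^sup>)| < |U\<^sup>(\<^sup>k\<^sup>)| < |V\<^sup>(\<^sup>k\<^sup>+\<^sup>1\<^sup>)|\<close>, the complexity is governed by disjoint intervals, and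
  the case distinction only reflects the parities of these lengths.\<close>

section \<open>Runs of zeros and the ones that end them\<close>

abbreviation zeros :: "nat \<Rightarrow> letter list" where
  "zeros i \<equiv> replicate i Zero"

lemma ex_letter_iff: "(\<exists>x. Q x) \<longleftrightarrow> Q Zero \<or> Q One"
  by (metis letter.exhaust)

text \<open>The first \<open>One\<close> ends the leading run, so the run length can be read off the
  word. The desubstitution arguments below rest on this.\<close>

lemma zeros_One_eq_iff:
  "zeros i @ One # s = zeros j @ One # t \<longleftrightarrow> i = j \<and> s = t"
proof (induction i arbitrary: j)
  case 0
  then show ?case by (cases j) auto
next
  case (Suc i)
  then show ?case by (cases j) auto
qed

lemma One_notin_iff: "One \<notin> set w \<longleftrightarrow> w = zeros (length w)"
proof (induction w)
  case (Cons x w)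
  then show ?case by (cases x) auto
qed simp

lemma split_first_One: "One \<in> set w \<Longrightarrow> \<exists>k s. w = zeros k @ One # s"
  using split_list_first One_notin_iff by metis

lemma split_last_One: "One \<in> set w \<Longrightarrow> \<exists>s k. w = s @ One # zeros k"
  using split_list_last One_notin_iff by metis

lemma zeros_One_cases:
  obtains (zeros) k where "w = zeros k" | (One) k s where "w = zeros k @ One # s"
  using split_first_One One_notin_iff by metis

lemma subst_Nil [simp]: "subst a b [] = []"
  by (simp add: subst_def)

lemma subst_Cons: "subst a b (x # w) = subst_letter a b x @ subst a b w"
  by (simp add: subst_def)

lemma length_T_map: "length w < length (T_map a b w)"
  using length_subst_ge[of w a b] by (simp add: T_map_def)

lemma sublist_subst: "sublist v w \<Longrightarrow> sublist (subst a b v) (subst a b w)"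
  unfolding sublist_def by (metis subst_append)

subsection \<open>Counting through interlacing intervals\<close>

text \<open>The intervals take integer endpoints so that one of them may start below \<open>0\<close>.\<close>

lemma interval_step:
  fixes l r :: "nat \<Rightarrow> int"
  assumes less: "\<And>k. I k \<Longrightarrow> l k < r k"
    and sep: "\<And>j k. I j \<Longrightarrow> I k \<Longrightarrow> j < k \<Longrightarrow> r j < l k"
    and parity: "\<And>k. I k \<Longrightarrow> even (l k - m) \<and> even (r k - m)"
  shows "of_bool (\<exists>k. I k \<and> l k < m + 2 \<and> m + 2 \<le> r k) + of_bool (\<exists>k. I k \<and> r k = m) =
    of_bool (\<exists>k. I k \<and> l k < m \<and> m \<le> r k) + (of_bool (\<exists>k. I k \<and> l k = m) :: int)"
proof -
  \<comment> \<open>Endpoints have the parity of \<open>m\<close> and so differ from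
    \<open>m + 1\<close>; comparisons with \<open>m + 2\<close> become comparisons with
    \<open>m\<close>.\<close>
  have l_iff: "l k < m + 2 \<longleftrightarrow> l k \<le> m" and r_iff: "m + 2 \<le> r k \<longleftrightarrow> m < r k" if "I k" for k
    using parity[OF that] by presburger+
  \<comment> \<open>At most one closed interval contains \<open>m\<close>, so a single index
    \<open>k\<close> settles each of the four existentials.\<close>
  have uniq: "j = k" if "I j" "I k" "l j \<le> m" "m \<le> r j" "l k \<le> m" "m \<le> r k" for j k
    using sep[OF that(1,2)] sep[OF that(2,1)] that by (cases j k rule: linorder_cases) auto
  show ?thesis
  proof (cases "\<exists>k. I k \<and> l k \<le> m \<and> m \<le> r k")
    case True
    then obtain k where k: "I k" "l k \<le> m" "m \<le> r k" by blast
    have "(\<exists>j. I j \<and> l j < m + 2 \<and> m + 2 \<le> r j) \<longleftrightarrow> m < r k"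
      using uniq k l_iff r_iff by (metis less_imp_le)
    moreover have "(\<exists>j. I j \<and> r j = m) \<longleftrightarrow> r k = m"
      using uniq k less by (metis less_imp_le order_refl)
    moreover have "(\<exists>j. I j \<and> l j < m \<and> m \<le> r j) \<longleftrightarrow> l k < m"
      using uniq k by (metis less_imp_le)
    moreover have "(\<exists>j. I j \<and> l j = m) \<longleftrightarrow> l k = m"
      using uniq k less by (metis less_imp_le order_refl)
    ultimately show ?thesis using k less[of k] by auto
  next
    case False
    have "\<not> (\<exists>j. I j \<and> l j < m + 2 \<and> m + 2 \<le> r j)"
      using False l_iff r_iff by (meson less_imp_le)
    moreover have "\<not> (\<exists>j. I j \<and> r j = m)" "\<not> (\<exists>j. I j \<and> l j < m \<and> m \<le> r j)"
      "\<not> (\<exists>j. I j \<and> l j = m)"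
      using False less by (meson less_imp_le order_refl)+
    ultimately show ?thesis by (simp only: of_bool_eq)
  qed
qed

text \<open>\<open>f\<close> rises by one on leaving a left endpoint and drops by one on leaving a
  right endpoint. By \<open>interval_step\<close> the indicator of the union of the half-open
  intervals changes in the same way, so agreement at the start propagates.\<close>

lemma interval_count:
  fixes l r :: "nat \<Rightarrow> int" and f :: "nat \<Rightarrow> int"
  assumes "\<And>k. I k \<Longrightarrow> l k < r k"
    and "\<And>j k. I j \<Longrightarrow> I k \<Longrightarrow> j < k \<Longrightarrow> r j < l k"
    and parity: "\<And>k. I k \<Longrightarrow> even (l k - m) \<and> even (r k - m)"
    and base: "f 0 = c + of_bool (\<exists>k. I k \<and> l k < m \<and> m \<le> r k)"
    and step: "\<And>n. f (Suc n) + of_bool (\<exists>k. I k \<and> r k = m + 2 * int n) =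
      f n + of_bool (\<exists>k. I k \<and> l k = m + 2 * int n)"
  shows "f n = c + of_bool (\<exists>k. I k \<and> l k < m + 2 * int n \<and> m + 2 * int n \<le> r k)"
proof (induction n)
  case (Suc n)
  have "even (l k - (m + 2 * int n)) \<and> even (r k - (m + 2 * int n))" if "I k" for k
    using parity[OF that] by simp
  from interval_step[of I l r "m + 2 * int n", OF assms(1,2) this]
  have "f (Suc n) = c + of_bool (\<exists>k. I k \<and> l k < m + 2 * int n + 2 \<and> m + 2 * int n + 2 \<le> r k)"
    using Suc step[of n] by linarith
  then show ?case by (simp add: algebra_simps)
qed (use base in simp)

section \<open>The substitution and its inversion\<close>

locale beta_subst =
  fixes a b :: nat
  assumes b_pos: "1 \<le> b" and b_less: "b < a - 1"
begin

abbreviation \<phi> :: "letter list \<Rightarrow> letter list" where "\<phi> \<equiv> subst a b"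

abbreviation T :: "letter list \<Rightarrow> letter list" where "T \<equiv> T_map a b"

text \<open>Gives both images the single form \<open>zeros (run x) @ [One]\<close>; since
  \<open>b < a\<close>, a letter is recovered from the run length of its image.\<close>

definition run :: "letter \<Rightarrow> nat" where
  "run x = (case x of Zero \<Rightarrow> a | One \<Rightarrow> b)"

lemma run_simps [simp]: "run Zero = a" "run One = b"
  by (simp_all add: run_def)

lemma run_eq_iff [simp]: "run x = run y \<longleftrightarrow> x = y"
  using b_less by (cases x; cases y) auto

lemma subst_Cons_run: "\<phi> (x # w) = zeros (run x) @ One # \<phi> w"
  by (cases x) (simp_all add: subst_Cons)

lemma subst_eq_zeros_One_iff:
  "\<phi> v = zeros i @ One # t \<longleftrightarrow> (\<exists>c v'. v = c # v' \<and> run c = i \<and> \<phi> v' = t)"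
  by (cases v) (auto simp: subst_Cons_run zeros_One_eq_iff)

lemma subst_inj: "\<phi> v = \<phi> w \<Longrightarrow> v = w"
proof (induction v arbitrary: w)
  case Nil
  then show ?case by (cases w) (auto simp: subst_Cons_run)
next
  case (Cons x v)
  then show ?case by (cases w) (auto simp: subst_Cons_run zeros_One_eq_iff)
qed

text \<open>The image of a letter contains exactly one \<open>One\<close>, at its end. Any
  \<open>One\<close> in \<open>\<phi> v\<close> therefore ends a block, and \<open>v\<close> can be
  cut there.\<close>

lemma subst_eq_append_One:
  assumes "\<phi> v = s @ One # t"
  obtains v1 v2 where "v = v1 @ v2" "\<phi> v1 = s @ [One]" "\<phi> v2 = t"
  using assms
proof (induction v arbitrary: s thesis)
  case Nil
  then show ?case by simp
next
  case (Cons x v)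
  show ?case
  proof (cases s rule: zeros_One_cases)
    case (zeros k)
    then have "run x = k" "\<phi> v = t"
      using Cons.prems(2) by (auto simp: subst_Cons_run zeros_One_eq_iff)
    then show ?thesis
      using Cons.prems(1)[of "[x]" v] zeros by (simp add: subst_Cons_run)
  next
    case (One k s')
    then have "run x = k" and v: "\<phi> v = s' @ One # t"
      using Cons.prems(2) by (auto simp: subst_Cons_run zeros_One_eq_iff)
    obtain v1 v2 where "v = v1 @ v2" "\<phi> v1 = s' @ [One]" "\<phi> v2 = t"
      using Cons.IH[OF _ v] .
    then show ?thesis
      using Cons.prems(1)[of "x # v1" v2] One \<open>run x = k\<close> by (simp add: subst_Cons_run)
  qed
qed

text \<open>With the extra leading \<open>One\<close>, every run of zeros is enclosed by ones, so
  reversal merely reverses the sequence of runs.\<close>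

lemma One_subst_rev: "rev (One # \<phi> v) = One # \<phi> (rev v)"
  by (induction v) (simp_all add: subst_append subst_Cons_run)

lemma T_map_inj: "T v = T w \<longleftrightarrow> v = w"
  using subst_inj by (auto simp: T_map_def)

lemma zeros_neq_T: "zeros k \<noteq> T v"
proof
  assume "zeros k = T v"
  then have "One \<in> set (zeros k)" by (simp add: T_map_def)
  then show False by simp
qed

subsection \<open>The language\<close>

text \<open>Working with the finite iterates keeps the limit word out of the combinatorics until
  \<open>factor_u_beta_iff\<close> identifies the two notions of factor.\<close>

definition lang :: "letter list set" where
  "lang = {w. \<exists>n. sublist w ((\<phi> ^^ n) [Zero])}"

lemma lang_sublist: "w \<in> lang \<Longrightarrow> sublist v w \<Longrightarrow> v \<in> lang"
  by (auto simp: lang_def intro: sublist_order.order.trans)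

lemma lang_middle: "p @ w @ q \<in> lang \<Longrightarrow> w \<in> lang"
  by (rule lang_sublist) (auto simp: sublist_def)

lemma Zero_lang: "[Zero] \<in> lang"
  unfolding lang_def by (auto intro: exI[of _ 0])

lemma subst_lang: "w \<in> lang \<Longrightarrow> \<phi> w \<in> lang"
proof -
  assume "w \<in> lang"
  then obtain n where "sublist w ((\<phi> ^^ n) [Zero])" by (auto simp: lang_def)
  then have "sublist (\<phi> w) ((\<phi> ^^ Suc n) [Zero])" using sublist_subst by simp
  then show ?thesis unfolding lang_def by blast
qed

lemma lang_subst_cases:
  assumes "w \<in> lang"
  obtains v where "v \<in> lang" "sublist w (\<phi> v)"
proof -
  obtain n where n: "sublist w ((\<phi> ^^ n) [Zero])"
    using assms by (auto simp: lang_def)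
  have "(\<phi> ^^ k) [Zero] \<in> lang" for k by (auto simp: lang_def)
  show ?thesis
  proof (cases n)
    case 0
    \<comment> \<open>The start word \<open>[Zero]\<close> is not an image, but it is a prefix of
      its own image.\<close>
    have "\<phi> [Zero] = [] @ [Zero] @ zeros (a - 1) @ [One]"
      using b_less by (cases a) (simp_all add: subst_Cons)
    then have "sublist [Zero] (\<phi> [Zero])" unfolding sublist_def by blast
    then show ?thesis
      using that[OF Zero_lang] n 0 by (auto intro: sublist_order.order.trans)
  next
    case (Suc k)
    then show ?thesis using that[of "(\<phi> ^^ k) [Zero]"] n by (auto simp: lang_def)
  qed
qed

text \<open>As \<open>a \<ge> 2\<close>, \<open>\<phi> [Zero]\<close> starts with two zeros, so
  iterate \<open>n + 1\<close> consists of iterate \<open>n\<close> twice and a non-empty rest. The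
  second copy has letters on both sides.\<close>

lemma lang_extend:
  assumes "w \<in> lang"
  obtains x y where "x # w @ [y] \<in> lang"
proof -
  obtain n where n: "sublist w ((\<phi> ^^ n) [Zero])"
    using assms by (auto simp: lang_def)
  let ?z = "(\<phi> ^^ n) [Zero]"
  obtain a' where a': "a = Suc (Suc a')"
    using b_less by (cases a; cases "a - 1") auto
  define r where "r = zeros a' @ [One]"
  have "\<phi> [Zero] = [Zero] @ [Zero] @ r"
    using subst_Cons_run[of Zero "[]"] by (simp only: run_simps) (simp add: a' r_def)
  then have eq: "(\<phi> ^^ Suc n) [Zero] = ?z @ ?z @ (\<phi> ^^ n) r"
    by (metis funpow_Suc_right o_apply subst_pow_append)
  have "?z \<noteq> []" "(\<phi> ^^ n) r \<noteq> []"
    using length_subst_pow_ge[of "[Zero]" n a b] length_subst_pow_ge[of r n a b]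
    by (auto simp: r_def)
  then obtain xs x y ys where "?z = xs @ [x]" "(\<phi> ^^ n) r = y # ys"
    by (meson list.exhaust rev_exhaust)
  moreover obtain p q where pq: "?z = p @ w @ q"
    using n by (auto simp: sublist_def)
  ultimately have "(\<phi> ^^ Suc n) [Zero] = xs @ x # p @ w @ q @ y # ys"
    unfolding eq by (metis append.assoc append_Cons append_Nil)
  then have *: "xs @ (x # p @ w @ q @ [y]) @ ys \<in> lang"
    by (auto simp: lang_def intro: exI[of _ "Suc n"])
  \<comment> \<open>The neighbours of \<open>w\<close> lie inside the second copy or, if
    \<open>p\<close> or \<open>q\<close> is empty, right next to it.\<close>
  obtain x' s where "x # p = s @ [x']" by (metis list.distinct(1) rev_exhaust)
  moreover obtain y' t where "q @ [y] = y' # t" by (metis append_is_Nil_conv list.exhaust not_Cons_self2)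
  ultimately have "x # p @ w @ q @ [y] = s @ (x' # w @ [y']) @ t"
    by (metis append.assoc append_Cons append_Nil)
  then show ?thesis
    using lang_middle[OF *] lang_middle that by metis
qed

text \<open>A left neighbour of \<open>v\<close> has an image ending in \<open>One\<close>, directly
  before \<open>\<phi> v\<close>.\<close>

lemma One_subst_lang: "v \<in> lang \<Longrightarrow> One # \<phi> v \<in> lang"
proof -
  assume "v \<in> lang"
  then obtain x y where "x # v @ [y] \<in> lang" by (rule lang_extend)
  then have "zeros (run x) @ (One # \<phi> v) @ \<phi> [y] \<in> lang"
    using subst_lang by (fastforce simp: subst_append subst_Cons_run)
  then show ?thesis by (rule lang_middle)
qed

text \<open>Both ones are block ends in some image, so only whole blocks lie between them.\<close>

lemma lang_desubst:
  assumes "One # r @ [One] \<in> lang"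
  obtains v where "v \<in> lang" "\<phi> v = r @ [One]"
proof -
  obtain v where v: "v \<in> lang" "sublist (One # r @ [One]) (\<phi> v)"
    using lang_subst_cases[OF assms] .
  then obtain p q where "\<phi> v = p @ One # (r @ One # q)"
    by (auto simp: sublist_def)
  then obtain v1 v2 where v12: "v = v1 @ v2" and "\<phi> v2 = r @ One # q"
    by (rule subst_eq_append_One)
  then obtain v3 v4 where "v2 = v3 @ v4" "\<phi> v3 = r @ [One]"
    by (metis subst_eq_append_One)
  then show ?thesis using that v v12 lang_middle by blast
qed

text \<open>Prolonging an occurrence of \<open>w\<close> on both sides up to the nearest
  \<open>One\<close> adds only zeros. The images of the neighbours \<open>c\<close> and
  \<open>d\<close> of \<open>v\<close> ensure that such ones exist.\<close>

lemma lang_One_zeros: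
  assumes "w \<in> lang"
  obtains i j where "One # zeros i @ w @ zeros j @ [One] \<in> lang"
proof -
  obtain v where v: "v \<in> lang" "sublist w (\<phi> v)"
    using lang_subst_cases[OF assms] .
  obtain c d where "c # v @ [d] \<in> lang" using lang_extend v by metis
  then have *: "zeros (run c) @ (One # \<phi> v @ zeros (run d) @ [One]) \<in> lang"
    using subst_lang by (fastforce simp: subst_append subst_Cons_run)
  obtain p q where pq: "\<phi> v = p @ w @ q" using v by (auto simp: sublist_def)
  obtain s i where 1: "One # p = s @ One # zeros i"
    using split_last_One[of "One # p"] by auto
  obtain t j where 2: "(q @ zeros (run d)) @ [One] = zeros j @ One # t"
    using split_first_One[of "(q @ zeros (run d)) @ [One]"] by auto
  have "One # \<phi> v @ zeros (run d) @ [One] = (One # p) @ w @ ((q @ zeros (run d)) @ [One])"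
    by (simp add: pq)
  also have "\<dots> = s @ (One # zeros i @ w @ zeros j @ [One]) @ t"
    unfolding 1 2 by simp
  finally show ?thesis
    using * that lang_middle[of "zeros (run c) @ s" "One # zeros i @ w @ zeros j @ [One]" t]
    by simp
qed

lemma One_lang: "[One] \<in> lang"
  using One_subst_lang[OF Zero_lang] lang_middle[of "[]" "[One]"] by simp

lemma letter_lang: "[x] \<in> lang"
  by (cases x) (simp_all add: One_lang Zero_lang)

lemma One_zeros_One_lang_iff: "One # zeros i @ [One] \<in> lang \<longleftrightarrow> i = a \<or> i = b"
proof
  assume "One # zeros i @ [One] \<in> lang"
  then obtain v where "\<phi> v = zeros i @ [One]" by (rule lang_desubst)
  then obtain c where "run c = i" by (auto simp: subst_eq_zeros_One_iff)
  then show "i = a \<or> i = b" by (cases c) auto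
next
  have "One # zeros (run x) @ [One] \<in> lang" for x
    using One_subst_lang[OF letter_lang, of x] by (simp add: subst_Cons_run)
  from this[of Zero] this[of One]
  show "i = a \<or> i = b \<Longrightarrow> One # zeros i @ [One] \<in> lang" by auto
qed

text \<open>A run inside a factor extends to a complete run, whose length is \<open>a\<close> or the
  smaller \<open>b\<close>.\<close>

lemma zeros_lang_iff: "zeros i \<in> lang \<longleftrightarrow> i \<le> a"
proof
  assume "zeros i \<in> lang"
  then obtain j k where "One # zeros j @ zeros i @ zeros k @ [One] \<in> lang"
    by (rule lang_One_zeros)
  then have "One # zeros (j + i + k) @ [One] \<in> lang" by (simp add: replicate_add)
  then show "i \<le> a" using b_less by (auto simp only: One_zeros_One_lang_iff)
next
  assume "i \<le> a"
  moreover have "[One] @ zeros a @ [One] \<in> lang" by (simp add: One_zeros_One_lang_iff)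
  then have "zeros a \<in> lang" by (rule lang_middle)
  moreover have "zeros a = zeros i @ zeros (a - i)"
    using \<open>i \<le> a\<close> by (simp flip: replicate_add)
  ultimately show "zeros i \<in> lang" using lang_middle[of "[]" "zeros i"] by simp
qed

text \<open>The outer ones make both outer runs complete, so these belong to the images of the two
  neighbours of \<open>v\<close>.\<close>

lemma One_zeros_subst_lang_iff:
  "One # zeros i @ One # \<phi> v @ zeros j @ [One] \<in> lang \<longleftrightarrow>
    (\<exists>c d. run c = i \<and> run d = j \<and> c # v @ [d] \<in> lang)"
proof
  assume "One # zeros i @ One # \<phi> v @ zeros j @ [One] \<in> lang"
  then obtain w where w: "w \<in> lang" "\<phi> w = zeros i @ One # \<phi> v @ zeros j @ [One]"
    using lang_desubst[of "zeros i @ One # \<phi> v @ zeros j"] by auto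
  then obtain c w' where c: "w = c # w'" "run c = i" "\<phi> w' = \<phi> v @ zeros j @ [One]"
    by (auto simp: subst_eq_zeros_One_iff)
  obtain d w'' where d: "w' = w'' @ [d]"
    using c(3) by (cases w' rule: rev_cases) auto
  then have "\<phi> w'' @ zeros (run d) = \<phi> v @ zeros j"
    using c by (simp add: subst_append subst_Cons_run)
  \<comment> \<open>Reversal moves the trailing run to the front, where
    \<open>zeros_One_eq_iff\<close> applies.\<close>
  then have "rev (One # \<phi> w'' @ zeros (run d)) = rev (One # \<phi> v @ zeros j)"
    by simp
  then have "zeros (run d) @ rev (One # \<phi> w'') = zeros j @ rev (One # \<phi> v)"
    by simp
  then have "run d = j \<and> \<phi> (rev w'') = \<phi> (rev v)"
    unfolding One_subst_rev by (simp add: zeros_One_eq_iff)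
  then have "run d = j" "w'' = v" using subst_inj by blast+
  then show "\<exists>c d. run c = i \<and> run d = j \<and> c # v @ [d] \<in> lang"
    using c d w by auto
next
  assume "\<exists>c d. run c = i \<and> run d = j \<and> c # v @ [d] \<in> lang"
  then show "One # zeros i @ One # \<phi> v @ zeros j @ [One] \<in> lang"
    using One_subst_lang by (fastforce simp: subst_append subst_Cons_run)
qed

lemma sym_One_lang_iff:
  "One # zeros i @ One # \<phi> v @ zeros i @ [One] \<in> lang \<longleftrightarrow>
    i = b \<and> One # v @ [One] \<in> lang \<or> i = a \<and> Zero # v @ [Zero] \<in> lang"
  unfolding One_zeros_subst_lang_iff ex_letter_iff using b_less by auto

text \<open>The outer runs may be parts of longer ones. Up to \<open>b\<close> zeros fit into either
  image, so any neighbours of \<open>v\<close> will do; more than \<open>b\<close> zeros force both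
  neighbours to be \<open>Zero\<close>.\<close>

lemma sym_zeros_lang_iff:
  "zeros i @ One # \<phi> v @ zeros i \<in> lang \<longleftrightarrow>
    i \<le> b \<and> v \<in> lang \<or> b < i \<and> i \<le> a \<and> Zero # v @ [Zero] \<in> lang"
proof
  assume "zeros i @ One # \<phi> v @ zeros i \<in> lang"
  then obtain j k where
    "One # zeros j @ (zeros i @ One # \<phi> v @ zeros i) @ zeros k @ [One] \<in> lang"
    by (rule lang_One_zeros)
  then have "One # zeros (j + i) @ One # \<phi> v @ zeros (i + k) @ [One] \<in> lang"
    by (simp add: replicate_add)
  then obtain c d where cd: "run c = j + i" "run d = i + k" "c # v @ [d] \<in> lang"
    unfolding One_zeros_subst_lang_iff by blast
  have "v \<in> lang" using cd(3) lang_middle[of "[c]" v "[d]"] by simp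
  then show "i \<le> b \<and> v \<in> lang \<or> b < i \<and> i \<le> a \<and> Zero # v @ [Zero] \<in> lang"
  proof (cases "i \<le> b")
    case False
    then have "c \<noteq> One" "d \<noteq> One" using cd by auto
    then have "c = Zero" "d = Zero" using letter.exhaust by blast+
    then show ?thesis using False cd by auto
  qed (use \<open>v \<in> lang\<close> in simp)
next
  assume *: "i \<le> b \<and> v \<in> lang \<or> b < i \<and> i \<le> a \<and> Zero # v @ [Zero] \<in> lang"
  obtain c d where cd: "c # v @ [d] \<in> lang" "i \<le> run c" "i \<le> run d"
  proof (cases "i \<le> b")
    case True
    then obtain c d where "c # v @ [d] \<in> lang" using * lang_extend by auto
    moreover have "i \<le> run x" for x using True b_less by (cases x) auto
    ultimately show ?thesis using that by blast
  qed (use * that run_simps in metis)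
  then have "One # zeros (run c) @ One # \<phi> v @ zeros (run d) @ [One] \<in> lang"
    unfolding One_zeros_subst_lang_iff by blast
  moreover have "zeros (run c) = zeros (run c - i) @ zeros i"
    and "zeros (run d) = zeros i @ zeros (run d - i)"
    using cd by (simp_all flip: replicate_add)
  ultimately show "zeros i @ One # \<phi> v @ zeros i \<in> lang"
    using lang_middle[of "One # zeros (run c - i)" "zeros i @ One # \<phi> v @ zeros i"
      "zeros (run d - i) @ [One]"] by simp
qed

text \<open>A factor of the limit uses finitely many positions, and some iterate agrees with the
  limit on all of them. Conversely, later iterates prolong earlier ones, so a prefix
  \<open>p @ w\<close> of one iterate is a prefix of the limit.\<close>

lemma factor_u_beta_iff: "factor w (u_beta a b) \<longleftrightarrow> w \<in> lang"
proof
  have lim: "word_tendsto (\<lambda>n. (\<phi> ^^ n) [Zero]) (u_beta a b)"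
    using word_tendsto_u_beta b_less by simp
  show "w \<in> lang" if "factor w (u_beta a b)"
  proof -
    obtain i j where ij: "i \<le> j" "w = subsequence (u_beta a b) i j"
      using \<open>factor w (u_beta a b)\<close> unfolding factor_def by blast
    have "\<forall>\<^sub>F n in sequentially. \<forall>t\<in>{..<j}. t < length ((\<phi> ^^ n) [Zero]) \<and>
        (\<phi> ^^ n) [Zero] ! t = u_beta a b t"
      by (rule eventually_ball_finite) (use lim in \<open>auto simp: word_tendsto_def\<close>)
    then obtain n where n: "\<forall>t<j. t < length ((\<phi> ^^ n) [Zero]) \<and>
        (\<phi> ^^ n) [Zero] ! t = u_beta a b t"
      unfolding eventually_sequentially by auto
    let ?z = "(\<phi> ^^ n) [Zero]"
    have "j \<le> length ?z" using n by (metis leI less_irrefl)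
    then have "w = take (j - i) (drop i ?z)"
      using n ij by (intro nth_equalityI) (auto simp: subsequence_def)
    then have "sublist w ?z"
      by (metis sublist_order.order.trans sublist_take sublist_drop)
    then show ?thesis by (auto simp: lang_def)
  qed
  show "factor w (u_beta a b)" if "w \<in> lang"
  proof -
    obtain n p q where n: "(\<phi> ^^ n) [Zero] = p @ w @ q"
      using \<open>w \<in> lang\<close> by (auto simp: lang_def sublist_def)
    have pre: "\<exists>s. (\<phi> ^^ m) [Zero] = p @ w @ s" if "n \<le> m" for m
      using that
    proof (induction m rule: dec_induct)
      case (step m)
      then show ?case using subst_pow_Suc_Zero[of a m b] b_less by force
    qed (use n in blast)
    have "(p @ w) ! t = u_beta a b t" if "t < length (p @ w)" for t
    proof -
      obtain N where N: "\<forall>m\<ge>N. (\<phi> ^^ m) [Zero] ! t = u_beta a b t"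
        using lim unfolding word_tendsto_def eventually_sequentially by blast
      obtain s where "(\<phi> ^^ max N n) [Zero] = p @ w @ s" using pre by (meson max.cobounded2)
      then have "(\<phi> ^^ max N n) [Zero] ! t = (p @ w) ! t"
        using that by (simp flip: append_assoc add: nth_append)
      then show ?thesis using N by simp
    qed
    \<comment> \<open>Letter \<open>t\<close> of \<open>w\<close> sits at position
      \<open>length p + t\<close>; the dummy leaves \<open>t\<close> schematic.\<close>
    from this[of "length p + _"]
    have "w = subsequence (u_beta a b) (length p) (length p + length w)"
      by (intro nth_equalityI) (auto simp: subsequence_def)
    then show ?thesis unfolding factor_def by (meson le_add1)
  qed
qed

subsection \<open>Palindromic extensions\<close>

lemma palindrome_zeros_subst_iff:
  "palindrome (zeros i @ One # \<phi> v @ zeros i) \<longleftrightarrow> palindrome v"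
proof -
  have "rev (zeros i @ One # \<phi> v @ zeros i) = zeros i @ rev (One # \<phi> v) @ zeros i"
    by simp
  then show ?thesis
    unfolding palindrome_def One_subst_rev using subst_inj by auto
qed

lemma T_map_eq: "T v = zeros b @ One # \<phi> v @ zeros b"
  by (simp add: T_map_def)

lemma palindrome_T_iff: "palindrome (T v) \<longleftrightarrow> palindrome v"
  by (simp add: T_map_eq palindrome_zeros_subst_iff)

text \<open>The padding by \<open>b\<close> zeros is present around \<open>One # \<phi> v\<close>
  whatever the neighbours of \<open>v\<close> are, as both images have at least \<open>b\<close>
  zeros.\<close>

lemma T_lang_iff: "T v \<in> lang \<longleftrightarrow> v \<in> lang"
  by (simp add: T_map_eq sym_zeros_lang_iff)

text \<open>By symmetry the outer runs have equal length, and what follows the first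
  \<open>One\<close> up to the last desubstitutes by \<open>lang_desubst\<close>. A single
  \<open>One\<close> corresponds to \<open>v = []\<close>.\<close>

lemma palindrome_lang_cases:
  assumes "palindrome p" "p \<in> lang"
  obtains (zeros) i where "p = zeros i"
    | (One) i v where "p = zeros i @ One # \<phi> v @ zeros i"
proof (cases p rule: zeros_One_cases)
  case (One i s)
  have rev: "rev p = p" using assms(1) by (simp add: palindrome_def)
  show ?thesis
  proof (cases "One \<in> set s")
    case False
    then obtain k where "s = zeros k" using One_notin_iff by blast
    then have "rev (zeros i @ One # zeros k) = zeros i @ One # zeros k"
      using rev One by metis
    then have "zeros k @ One # zeros i = zeros i @ One # zeros k"
      by (simp only: rev_append rev.simps rev_replicate append_assoc append_Cons append_Nil)
    then have "k = i" unfolding zeros_One_eq_iff by blast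
    then have "p = zeros i @ One # \<phi> [] @ zeros i"
      using One \<open>s = zeros k\<close> by simp
    then show ?thesis by (rule that(2))
  next
    case True
    then obtain r k where s: "s = r @ One # zeros k" using split_last_One by blast
    then have "rev (zeros i @ One # r @ One # zeros k) = zeros i @ One # r @ One # zeros k"
      using rev One by metis
    then have "zeros k @ One # rev r @ One # zeros i = zeros i @ One # r @ One # zeros k"
      by (simp only: rev_append rev.simps rev_replicate append_assoc append_Cons append_Nil)
    then have "k = i" unfolding zeros_One_eq_iff by blast
    have "One # r @ [One] \<in> lang"
      using assms(2) lang_middle[of "zeros i" "One # r @ [One]" "zeros k"] One s by simp
    then obtain v where "\<phi> v = r @ [One]" by (rule lang_desubst)
    then have "p = zeros i @ One # \<phi> v @ zeros i" using One s \<open>k = i\<close> by simp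
    then show ?thesis by (rule that(2))
  qed
qed

text \<open>The set written \<open>E(p)\<close> in the introductory text.\<close>

definition pal_ext :: "letter list \<Rightarrow> letter set" where
  "pal_ext p = {x. x # p @ [x] \<in> lang}"

lemma card_pal_ext:
  "card (pal_ext p) = of_bool (Zero # p @ [Zero] \<in> lang) + of_bool (One # p @ [One] \<in> lang)"
proof -
  have "pal_ext p = (if Zero # p @ [Zero] \<in> lang then {Zero} else {}) \<union>
      (if One # p @ [One] \<in> lang then {One} else {})"
  proof (rule set_eqI)
    fix x
    show "x \<in> pal_ext p \<longleftrightarrow> x \<in> (if Zero # p @ [Zero] \<in> lang then {Zero} else {}) \<union>
        (if One # p @ [One] \<in> lang then {One} else {})"
      by (cases x) (auto simp: pal_ext_def)
  qed
  then show ?thesis by simp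
qed

lemma Zero_zeros_lang_iff: "Zero # zeros i @ [Zero] \<in> lang \<longleftrightarrow> i + 2 \<le> a"
  using zeros_lang_iff[of "i + 2"] by (simp add: replicate_append_same)

lemma Zero_sym_lang_iff:
  "Zero # (zeros i @ One # \<phi> v @ zeros i) @ [Zero] \<in> lang \<longleftrightarrow>
    Suc i \<le> b \<and> v \<in> lang \<or> b < Suc i \<and> Suc i \<le> a \<and> Zero # v @ [Zero] \<in> lang"
  using sym_zeros_lang_iff[of "Suc i" v] by (simp add: replicate_append_same)

text \<open>Adding \<open>Zero\<close> around \<open>T v\<close> gives runs longer than
  \<open>b\<close>, which force \<open>Zero\<close> on both sides of \<open>v\<close>; adding
  \<open>One\<close> closes runs of exactly \<open>b\<close>, which force \<open>One\<close>
  there.\<close>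

lemma card_pal_ext_T:
  assumes "T v \<in> lang"
  shows "card (pal_ext (T v)) = card (pal_ext v)"
proof -
  have "Suc b \<le> a" "b \<noteq> a" using b_less by auto
  then show ?thesis
    using assms Zero_sym_lang_iff[of b v] sym_One_lang_iff[of b v]
    by (simp add: card_pal_ext T_map_eq)
qed

lemma zeros_eq_T_pow_iff: "zeros i = (T ^^ k) (zeros m) \<longleftrightarrow> k = 0 \<and> i = m"
  by (cases k) (auto simp: zeros_neq_T)

lemma T_eq_T_pow_iff: "(\<exists>k. T v = (T ^^ k) (zeros m)) \<longleftrightarrow> (\<exists>k. v = (T ^^ k) (zeros m))"
proof
  assume "\<exists>k. T v = (T ^^ k) (zeros m)"
  then obtain k where k: "T v = (T ^^ k) (zeros m)" by blast
  then show "\<exists>k. v = (T ^^ k) (zeros m)"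
    by (cases k) (use not_sym[OF zeros_neq_T] T_map_inj in auto)
next
  assume "\<exists>k. v = (T ^^ k) (zeros m)"
  then show "\<exists>k. T v = (T ^^ k) (zeros m)" by (metis funpow.simps(2) o_apply)
qed

text \<open>For \<open>k > 0\<close> the iterate has exactly \<open>b\<close> zeros before its first
  \<open>One\<close>; for \<open>k = 0\<close> it has no \<open>One\<close>.\<close>

lemma zeros_One_neq_T_pow:
  assumes "i \<noteq> b"
  shows "zeros i @ One # s \<noteq> (T ^^ k) (zeros m)"
proof (cases k)
  case 0
  have "One \<in> set (zeros i @ One # s)" "One \<notin> set (zeros m)" by auto
  then show ?thesis using 0 by (metis funpow_0)
qed (use assms in \<open>auto simp: T_map_eq zeros_One_eq_iff\<close>)

text \<open>Stated additively to avoid subtraction on naturals. \<open>T\<close> preserves both the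
  number of extensions and the property of being an iterate, so only words that are not of the form
  \<open>T v\<close> need a direct computation.\<close>

lemma card_pal_ext_eq:
  assumes "palindrome p" "p \<in> lang"
  shows "card (pal_ext p) + of_bool (\<exists>k. p = (T ^^ k) (zeros (a - 1))) =
    1 + of_bool (\<exists>k. p = (T ^^ k) (zeros b))"
  using assms
proof (induction p rule: measure_induct_rule[of length])
  case (less p)
  from less.prems show ?case
  proof (cases p rule: palindrome_lang_cases)
    case (zeros i)
    have "i \<le> a" using zeros less.prems zeros_lang_iff by simp
    \<comment> \<open>\<open>Zero\<close> extends iff \<open>i + 2 \<le> a\<close>, and
      \<open>One\<close> iff \<open>i\<close> is \<open>a\<close> or \<open>b\<close>: two letters
      for \<open>i = b\<close>, none for \<open>i = a - 1\<close>, one otherwise.\<close>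
    then show ?thesis
      using b_less unfolding zeros card_pal_ext
      by (auto simp: Zero_zeros_lang_iff One_zeros_One_lang_iff zeros_eq_T_pow_iff)
  next
    case (One i v)
    show ?thesis
    proof (cases "i = b")
      case True
      then have p: "p = T v" using One by (simp add: T_map_eq)
      then show ?thesis
        using less length_T_map card_pal_ext_T
        by (simp add: palindrome_T_iff T_lang_iff T_eq_T_pow_iff)
    next
      case False
      \<comment> \<open>For \<open>i < a\<close> only \<open>Zero\<close> extends, for
        \<open>i = a\<close> only \<open>One\<close>; and \<open>i \<noteq> b\<close> excludes both
        families of iterates.\<close>
      then show ?thesis
        using less.prems b_less unfolding One card_pal_ext
        by (auto simp: zeros_One_neq_T_pow sym_zeros_lang_iff Zero_sym_lang_iff[simplified]
            sym_One_lang_iff)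
    qed
  qed
qed

subsection \<open>The recurrence for the palindromic complexity\<close>

definition pals :: "nat \<Rightarrow> letter list set" where
  "pals m = {w. length w = m \<and> palindrome w \<and> w \<in> lang}"

lemma pal_complexity_eq: "pal_complexity (u_beta a b) m = card (pals m)"
  by (simp add: pal_complexity_def pals_def factor_u_beta_iff)

lemma finite_letter [simp]: "finite (A :: letter set)"
proof (rule finite_subset)
  show "A \<subseteq> {Zero, One}" using letter.exhaust by blast
qed simp

lemma finite_pals [simp]: "finite (pals m)"
  by (rule finite_subset[OF _ finite_lists_length_eq[of UNIV m]]) (auto simp: pals_def)

lemma card_pals_0: "card (pals 0) = 1"
proof -
  have "[] \<in> lang" using zeros_lang_iff[of 0] by simp
  then have "pals 0 = {[]}" by (auto simp: pals_def palindrome_def)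
  then show ?thesis by simp
qed

lemma card_pals_1: "card (pals 1) = 2"
proof -
  have "pals 1 = {[Zero], [One]}"
  proof (rule set_eqI)
    fix w
    show "w \<in> pals 1 \<longleftrightarrow> w \<in> {[Zero], [One]}"
    proof (cases "\<exists>x. w = [x]")
      case True
      then obtain x where "w = [x]" by blast
      then show ?thesis
        using letter_lang[of x] by (cases x) (auto simp: pals_def palindrome_def)
    qed (auto simp: pals_def length_Suc_conv)
  qed
  then show ?thesis by simp
qed

text \<open>Removing the two equal outer letters is a bijection onto the pairs of a shorter
  palindrome and one of its extensions.\<close>

lemma card_pals_add_2: "card (pals (m + 2)) = (\<Sum>p\<in>pals m. card (pal_ext p))"
proof -
  have "bij_betw (\<lambda>(p, x). x # p @ [x]) (Sigma (pals m) pal_ext) (pals (m + 2))"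
    unfolding bij_betw_def
  proof (intro conjI set_eqI iffI)
    show "inj_on (\<lambda>(p, x). x # p @ [x]) (Sigma (pals m) pal_ext)"
      by (auto simp: inj_on_def)
  next
    fix w assume "w \<in> (\<lambda>(p, x). x # p @ [x]) ` Sigma (pals m) pal_ext"
    then show "w \<in> pals (m + 2)"
      by (auto simp: pals_def palindrome_def pal_ext_def)
  next
    fix w assume w: "w \<in> pals (m + 2)"
    obtain x w' where 1: "w = x # w'" using w by (cases w) (auto simp: pals_def)
    obtain p y where "w' = p @ [y]"
      using w 1 by (cases w' rule: rev_cases) (auto simp: pals_def)
    with w 1 have p: "w = x # p @ [y]" "length p = m" by (auto simp: pals_def)
    have pal: "rev w = w" and lang: "w \<in> lang"
      using w by (simp_all add: pals_def palindrome_def)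
    from pal have "y # (rev p @ [x]) = x # (p @ [y])"
      unfolding p(1) by (simp only: rev.simps rev_append append_Cons append_Nil append_assoc)
    then have "y = x" "rev p @ [x] = p @ [y]" by blast+
    then have "palindrome p" unfolding palindrome_def by blast
    moreover have "p \<in> lang" using lang lang_middle[of "[x]" p "[y]"] p(1) by simp
    moreover note \<open>y = x\<close>
    ultimately have "(p, x) \<in> Sigma (pals m) pal_ext"
      using p lang by (simp add: pals_def pal_ext_def)
    moreover have "w = (\<lambda>(p, x). x # p @ [x]) (p, x)" using p(1) \<open>y = x\<close> by simp
    ultimately show "w \<in> (\<lambda>(p, x). x # p @ [x]) ` Sigma (pals m) pal_ext"
      by (rule rev_image_eqI)
  qed
  then have "card (Sigma (pals m) pal_ext) = card (pals (m + 2))"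
    by (rule bij_betw_same_card)
  moreover have "card (Sigma (pals m) pal_ext) = (\<Sum>p\<in>pals m. card (pal_ext p))"
    by (rule card_SigmaI) simp_all
  ultimately show ?thesis by simp
qed

lemma length_T_pow_strict_mono: "strict_mono (\<lambda>k. length ((T ^^ k) w))"
  unfolding strict_mono_Suc_iff using length_T_map by simp

lemma T_pow_palindrome_lang:
  assumes "m \<le> a"
  shows "palindrome ((T ^^ k) (zeros m)) \<and> (T ^^ k) (zeros m) \<in> lang"
  using assms
  by (induction k) (simp_all add: palindrome_T_iff T_lang_iff zeros_lang_iff, simp add: palindrome_def)

text \<open>\<open>T\<close> strictly lengthens words, so at most one iterate has length
  \<open>m\<close>; \<open>l \<le> a\<close> makes every iterate a palindromic factor, so it is
  counted.\<close>

lemma sum_pals_T_pow: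
  assumes "l \<le> a"
  shows "(\<Sum>p\<in>pals m. of_bool (\<exists>k. p = (T ^^ k) (zeros l))) =
    (of_bool (\<exists>k. length ((T ^^ k) (zeros l)) = m) :: nat)"
proof -
  let ?S = "pals m \<inter> {p. \<exists>k. p = (T ^^ k) (zeros l)}"
  have "(\<Sum>p\<in>pals m. of_bool (\<exists>k. p = (T ^^ k) (zeros l))) = card ?S"
    by (simp add: of_bool_def sum.If_cases)
  also have "\<dots> = of_bool (\<exists>k. length ((T ^^ k) (zeros l)) = m)"
  proof (cases "\<exists>k. length ((T ^^ k) (zeros l)) = m")
    case True
    then obtain k where k: "length ((T ^^ k) (zeros l)) = m" by blast
    have "j = k" if "length ((T ^^ j) (zeros l)) = m" for j
      using injD[OF strict_mono_imp_inj_on[OF length_T_pow_strict_mono], of j "zeros l" k] that k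
      by simp
    then have "p = (T ^^ k) (zeros l)" if "p \<in> ?S" for p
      using that by (auto simp only: Int_iff mem_Collect_eq pals_def)
    moreover have "(T ^^ k) (zeros l) \<in> ?S"
      using k T_pow_palindrome_lang[OF assms] unfolding pals_def by blast
    ultimately have "?S = {(T ^^ k) (zeros l)}" by blast
    then show ?thesis using True by simp
  next
    case False
    then have "?S = {}" by (auto simp: pals_def)
    then show ?thesis using False by simp
  qed
  finally show ?thesis .
qed

text \<open>This is \<open>card_pal_ext_eq\<close> summed over \<open>pals m\<close>.\<close>

lemma card_pals_recurrence:
  "card (pals (m + 2)) + of_bool (\<exists>k\<ge>1. length (U_word a b k) = m) =
    card (pals m) + of_bool (\<exists>k\<ge>1. length (V_word a b k) = m)"
proof -
  \<comment> \<open>\<open>U_word\<close> and \<open>V_word\<close> at index \<open>k\<close> apply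
    \<open>T\<close> only \<open>k - 1\<close> times.\<close>
  have shift: "(\<exists>k\<ge>1. Q (k - 1)) \<longleftrightarrow> (\<exists>k. Q k)" for Q :: "nat \<Rightarrow> bool"
    by (metis diff_Suc_1 le_add1 plus_1_eq_Suc)
  let ?Q = "\<lambda>l. \<exists>k. length ((T ^^ k) (zeros l)) = m"
  have "(\<Sum>p\<in>pals m. card (pal_ext p) + of_bool (\<exists>k. p = (T ^^ k) (zeros (a - 1)))) =
      (\<Sum>p\<in>pals m. 1 + of_bool (\<exists>k. p = (T ^^ k) (zeros b)))"
    by (intro sum.cong card_pal_ext_eq refl) (auto simp: pals_def)
  moreover have "a - 1 \<le> a" "b \<le> a" using b_less by auto
  ultimately have "card (pals (m + 2)) + of_bool (?Q (a - 1)) = card (pals m) + of_bool (?Q b)"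
    by (simp only: card_pals_add_2 sum.distrib sum_pals_T_pow) simp
  then show ?thesis
    unfolding U_word_def V_word_def
    using shift[of "\<lambda>k. length ((T ^^ k) (zeros (a - 1))) = m"]
      shift[of "\<lambda>k. length ((T ^^ k) (zeros b)) = m"] by simp
qed

subsection \<open>Lengths of the exceptional palindromes\<close>

abbreviation zs :: "letter list \<Rightarrow> nat" where "zs w \<equiv> count_list w Zero"

abbreviation os :: "letter list \<Rightarrow> nat" where "os w \<equiv> count_list w One"

lemma length_eq_zs_os: "length w = zs w + os w"
proof (induction w)
  case (Cons x w)
  then show ?case by (cases x) auto
qed simp

lemma count_list_zeros [simp]: "zs (zeros m) = m" "os (zeros m) = 0"
  by (induction m) auto

lemma count_list_subst: "zs (\<phi> w) = a * zs w + b * os w" "os (\<phi> w) = zs w + os w"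
proof (induction w)
  case (Cons x w)
  {
    case 1
    show ?case using Cons by (cases x) (simp_all add: subst_Cons)
  next
    case 2
    show ?case using Cons by (cases x) (simp_all add: subst_Cons)
  }
qed simp_all

lemma count_list_T: "zs (T w) = a * zs w + b * os w + 2 * b" "os (T w) = zs w + os w + 1"
  by (simp_all add: T_map_eq count_list_subst)

text \<open>Length alone does not control growth under \<open>T\<close>, since the two letters have
  images of different lengths; the comparison is carried through the letter counts.\<close>

lemma T_pow_count_less:
  assumes "zs v < zs w" "os v \<le> os w"
  shows "zs ((T ^^ k) v) < zs ((T ^^ k) w) \<and> os ((T ^^ k) v) \<le> os ((T ^^ k) w)"
proof (induction k)
  case (Suc k)
  let ?v = "(T ^^ k) v" and ?w = "(T ^^ k) w"
  have "a * zs ?v < a * zs ?w" "b * os ?v \<le> b * os ?w"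
    using Suc b_less by auto
  then have "a * zs ?v + b * os ?v < a * zs ?w + b * os ?w"
    by (rule add_less_le_mono)
  then show ?case using Suc by (simp add: count_list_T)
qed (use assms in simp)

lemma length_T_pow_less:
  assumes "zs v < zs w" "os v \<le> os w"
  shows "length ((T ^^ k) v) < length ((T ^^ k) w)"
  using T_pow_count_less[OF assms, of k] by (simp add: length_eq_zs_os)

lemma length_V_less_U: "length (V_word a b k) < length (U_word a b k)"
  unfolding U_word_def V_word_def by (rule length_T_pow_less) (use b_less in auto)

lemma length_U_less_V_Suc:
  assumes "1 \<le> k"
  shows "length (U_word a b k) < length (V_word a b (Suc k))"
proof -
  \<comment> \<open>\<open>T (zeros b)\<close> is \<open>V_word\<close> at index 2; its
    \<open>a * b + 2 * b\<close> zeros exceed the \<open>a - 1\<close> of \<open>U_word\<close> at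
    index 1.\<close>
  have "a * b + 2 * b \<ge> a" using b_pos by (metis le_add1 le_trans mult_le_mono2 mult_1_right)
  then have "length ((T ^^ (k - 1)) (zeros (a - 1))) < length ((T ^^ (k - 1)) (T (zeros b)))"
    using b_less by (intro length_T_pow_less) (auto simp: count_list_T)
  then show ?thesis
    using assms by (cases k) (simp_all add: U_word_def V_word_def funpow_swap1)
qed

lemma length_V_mono:
  assumes "1 \<le> j" "j \<le> k"
  shows "length (V_word a b j) \<le> length (V_word a b k)"
  using assms monoD[OF strict_mono_mono[OF length_T_pow_strict_mono], of "j - 1" "k - 1" "zeros b"]
  by (simp add: V_word_def)

lemma length_U_less_V:
  assumes "1 \<le> j" "j < k"
  shows "length (U_word a b j) < length (V_word a b k)"
  using length_U_less_V_Suc[OF assms(1)] length_V_mono[of "Suc j" k] assms by simp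

text \<open>Modulo 2, each \<open>T\<close> keeps the number of zeros even and changes the parity of
  the number of ones.\<close>

lemma even_length_T_pow_b_even:
  assumes "even b" "even (zs w)" "even (os w)"
  shows "even (length ((T ^^ k) w)) \<longleftrightarrow> even k"
proof -
  have "even (zs ((T ^^ k) w)) \<and> (even (os ((T ^^ k) w)) \<longleftrightarrow> even k)"
    by (induction k) (use assms in \<open>auto simp: count_list_T\<close>)
  then show ?thesis by (simp add: length_eq_zs_os)
qed

text \<open>Modulo 2, \<open>T\<close> sends the counts \<open>(z, o)\<close> to
  \<open>(o, z + o + 1)\<close>. From \<open>(1, 0)\<close> this passes through
  \<open>(0, 0)\<close> and \<open>(0, 1)\<close> with period 3, and the length is even only at
  \<open>(0, 0)\<close>.\<close>

lemma even_length_T_pow_b_odd: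
  assumes "even a" "odd b" "odd m"
  shows "even (length ((T ^^ k) (zeros m))) \<longleftrightarrow> k mod 3 = 1"
proof -
  have "(odd (zs ((T ^^ k) (zeros m))) \<longleftrightarrow> k mod 3 = 0) \<and>
      (odd (os ((T ^^ k) (zeros m))) \<longleftrightarrow> k mod 3 = 2)"
  proof (induction k)
    case (Suc k)
    have "k mod 3 = 0 \<or> k mod 3 = 1 \<or> k mod 3 = 2" by linarith
    with Suc assms show ?case by (auto simp: count_list_T mod_Suc)
  qed (use assms in simp)
  moreover have "k mod 3 = 0 \<or> k mod 3 = 1 \<or> k mod 3 = 2" by linarith
  ultimately show ?thesis by (auto simp: length_eq_zs_os)
qed

text \<open>The length is \<open>(a + 1) * zs w + (b + 1) * os w + 2 * b + 1\<close>.\<close>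

lemma odd_length_T: "odd a \<Longrightarrow> odd b \<Longrightarrow> odd (length (T w))"
  by (simp add: length_eq_zs_os count_list_T)

lemma even_length_V_b_even:
  assumes "even b" "1 \<le> k"
  shows "even (length (V_word a b k)) \<longleftrightarrow> odd k"
  using even_length_T_pow_b_even[of "zeros b" "k - 1"] assms by (simp add: V_word_def)

lemma even_length_U_a_odd:
  assumes "even b" "odd a" "1 \<le> k"
  shows "even (length (U_word a b k)) \<longleftrightarrow> odd k"
  using even_length_T_pow_b_even[of "zeros (a - 1)" "k - 1"] assms by (simp add: U_word_def)

lemma even_length_U_a_even:
  assumes "even b" "even a" "1 \<le> k"
  shows "even (length (U_word a b k)) \<longleftrightarrow> even k"
proof (cases "k = 1")
  case True
  then show ?thesis using assms b_less by (simp add: U_word_def)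
next
  case False
  then obtain j where j: "k = Suc (Suc j)" using assms(3) by (cases k; cases "k - 1") auto
  \<comment> \<open>\<open>zeros (a - 1)\<close> has an odd number of zeros, but one application of
    \<open>T\<close> gives the even counts \<open>a * (a - 1) + 2 * b\<close> and
    \<open>a\<close>.\<close>
  have "even (length ((T ^^ j) (T (zeros (a - 1))))) \<longleftrightarrow> even j"
    by (rule even_length_T_pow_b_even) (use assms b_less in \<open>auto simp: count_list_T\<close>)
  then show ?thesis by (simp add: U_word_def j funpow_swap1)
qed

lemma even_length_V_b_odd:
  assumes "even a" "odd b" "1 \<le> k"
  shows "even (length (V_word a b k)) \<longleftrightarrow> k mod 3 = 2"
  using even_length_T_pow_b_odd[of b "k - 1"] assms
  by (cases k) (auto simp: V_word_def mod_Suc split: if_splits)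

lemma even_length_U_b_odd:
  assumes "even a" "odd b" "1 \<le> k"
  shows "even (length (U_word a b k)) \<longleftrightarrow> k mod 3 = 2"
  using even_length_T_pow_b_odd[of "a - 1" "k - 1"] assms b_less
  by (cases k) (auto simp: U_word_def mod_Suc split: if_splits)

lemma odd_length_V_odd:
  assumes "odd a" "odd b"
  shows "odd (length (V_word a b k))"
  by (cases "k - 1") (use assms odd_length_T in \<open>auto simp: V_word_def\<close>)

lemma even_length_U_odd:
  assumes "odd a" "odd b" "1 \<le> k"
  shows "even (length (U_word a b k)) \<longleftrightarrow> k = 1"
  by (cases "k - 1") (use assms odd_length_T in \<open>auto simp: U_word_def\<close>)

subsection \<open>The four parity cases\<close>

abbreviation lU :: "nat \<Rightarrow> nat" where "lU k \<equiv> length (U_word a b k)"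

abbreviation lV :: "nat \<Rightarrow> nat" where "lV k \<equiv> length (V_word a b k)"

text \<open>Transfers the recurrence to \<open>interval_count\<close> along the lengths of the
  parity of \<open>m\<close>. By \<open>U\<close> and \<open>V\<close>, at such lengths the right
  and left endpoints are exactly the lengths of the two families; how the intervals are indexed and
  paired is left open.\<close>

lemma card_pals_interval:
  fixes l r :: "nat \<Rightarrow> int" and c :: nat
  assumes "\<And>k. I k \<Longrightarrow> l k < r k"
    and "\<And>j k. I j \<Longrightarrow> I k \<Longrightarrow> j < k \<Longrightarrow> r j < l k"
    and "\<And>k. I k \<Longrightarrow> even (l k - int m) \<and> even (r k - int m)"
    and "card (pals m) = c + of_bool (\<exists>k. I k \<and> l k < int m \<and> int m \<le> r k)"
    and U: "\<And>i. even (i + m) \<Longrightarrow> (\<exists>k\<ge>1. lU k = i) \<longleftrightarrow> (\<exists>k. I k \<and> r k = int i)"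
    and V: "\<And>i. even (i + m) \<Longrightarrow> (\<exists>k\<ge>1. lV k = i) \<longleftrightarrow> (\<exists>k. I k \<and> l k = int i)"
  shows "card (pals (2 * n + m)) =
    c + of_bool (\<exists>k. I k \<and> l k < int (2 * n + m) \<and> int (2 * n + m) \<le> r k)"
proof -
  have "int (card (pals (2 * n + m))) =
      int c + of_bool (\<exists>k. I k \<and> l k < int m + 2 * int n \<and> int m + 2 * int n \<le> r k)"
  proof (rule interval_count[where f = "\<lambda>n. int (card (pals (2 * n + m)))" and I = I,
        OF assms(1-3)])
    fix n
    have eq: "int m + 2 * int n = int (2 * n + m)" "2 * Suc n + m = 2 * n + m + 2" by simp_all
    have ev: "even (2 * n + m + m)" by simp
    have "int (card (pals (2 * n + m + 2)) + of_bool (\<exists>k\<ge>1. lU k = 2 * n + m)) =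
        int (card (pals (2 * n + m)) + of_bool (\<exists>k\<ge>1. lV k = 2 * n + m))"
      by (simp only: card_pals_recurrence)
    then show "int (card (pals (2 * Suc n + m))) +
        of_bool (\<exists>k. I k \<and> r k = int m + 2 * int n) =
        int (card (pals (2 * n + m))) + of_bool (\<exists>k. I k \<and> l k = int m + 2 * int n)"
      unfolding eq U[OF ev, symmetric] V[OF ev, symmetric] by (simp only: of_nat_add of_nat_of_bool)
  next
    show "int (card (pals (2 * 0 + m))) =
        int c + of_bool (\<exists>k. I k \<and> l k < int m \<and> int m \<le> r k)"
      using assms(4) by (simp only: mult_0_right add_0 of_nat_add of_nat_of_bool)
  qed
  then have "int (card (pals (2 * n + m))) =
      int (c + of_bool (\<exists>k. I k \<and> l k < int (2 * n + m) \<and> int (2 * n + m) \<le> r k))"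
    by (simp only: of_nat_add of_nat_of_bool of_nat_mult of_nat_numeral add.commute)
  then show ?thesis by (rule of_nat_eq_iff[THEN iffD1])
qed

text \<open>With equal parities the interval from \<open>lV k\<close> to \<open>lU k\<close> affects
  one parity class only, so each class keeps its own indices. The constant \<open>m + 1\<close> is
  the number of palindromes of length \<open>m\<close>.\<close>

lemma card_pals_same_parity:
  assumes parity: "\<And>k. 1 \<le> k \<Longrightarrow> even (lU k) \<longleftrightarrow> even (lV k)" and "m \<le> 1"
  shows "card (pals (2 * n + m)) =
    m + 1 + of_bool (\<exists>k\<ge>1. even (lV k + m) \<and> lV k < 2 * n + m \<and> 2 * n + m \<le> lU k)"
proof -
  have "card (pals (2 * n + m)) =
    m + 1 + of_bool (\<exists>k. (1 \<le> k \<and> even (lV k + m)) \<and>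
      int (lV k) < int (2 * n + m) \<and> int (2 * n + m) \<le> int (lU k))"
  proof (rule card_pals_interval)
    have "\<not> lV k < m" if "even (lV k + m)" for k
      using that \<open>m \<le> 1\<close> by presburger
    moreover have "card (pals m) = m + 1"
      using \<open>m \<le> 1\<close> card_pals_0 card_pals_1 by (cases m) auto
    ultimately show "card (pals m) = m + 1 + of_bool (\<exists>k. (1 \<le> k \<and> even (lV k + m)) \<and>
        int (lV k) < int m \<and> int m \<le> int (lU k))"
      by auto
  qed (use parity length_V_less_U length_U_less_V in auto)
  then show ?thesis by (simp add: conj_assoc flip: of_nat_add of_nat_mult)
qed

text \<open>Even lengths occur at odd indices and odd lengths at even ones; what remains is
  reindexing.\<close>

lemma card_pals_b_even_a_odd:
  assumes "even b" "odd a"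
  shows "card (pals (2 * n)) =
      (if \<exists>k\<ge>1. lV (2 * k - 1) < 2 * n \<and> 2 * n \<le> lU (2 * k - 1) then 2 else 1)"
    and "card (pals (2 * n + 1)) =
      (if \<exists>k\<ge>1. lV (2 * k) < 2 * n + 1 \<and> 2 * n + 1 \<le> lU (2 * k) then 3 else 2)"
proof -
  have par: "even (lV k) \<longleftrightarrow> odd k" "even (lU k) \<longleftrightarrow> even (lV k)" if "1 \<le> k" for k
    using even_length_V_b_even even_length_U_a_odd assms that by auto
  have odd: "(\<exists>k\<ge>1. even (lV k) \<and> Q k) \<longleftrightarrow> (\<exists>k\<ge>1. Q (2 * k - 1))" for Q
  proof
    assume "\<exists>k\<ge>1. even (lV k) \<and> Q k"
    then obtain k where "odd k" "Q k" using par by blast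
    then obtain j where "k = 2 * Suc j - 1" by (auto elim!: oddE)
    with \<open>Q k\<close> show "\<exists>k\<ge>1. Q (2 * k - 1)" by (metis le_add1 plus_1_eq_Suc)
  next
    assume "\<exists>k\<ge>1. Q (2 * k - 1)"
    then obtain k where "1 \<le> k" "Q (2 * k - 1)" by blast
    moreover have "odd (2 * k - 1)" "1 \<le> 2 * k - 1" using \<open>1 \<le> k\<close> by auto
    ultimately show "\<exists>k\<ge>1. even (lV k) \<and> Q k" using par by blast
  qed
  have even: "(\<exists>k\<ge>1. even (lV k + 1) \<and> Q k) \<longleftrightarrow> (\<exists>k\<ge>1. Q (2 * k))" for Q
  proof
    assume "\<exists>k\<ge>1. even (lV k + 1) \<and> Q k"
    then obtain k where "even k" "Q k" "1 \<le> k" using par by auto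
    then show "\<exists>k\<ge>1. Q (2 * k)" by (auto elim!: evenE)
  next
    assume "\<exists>k\<ge>1. Q (2 * k)"
    then obtain k where "1 \<le> k" "Q (2 * k)" by blast
    then show "\<exists>k\<ge>1. even (lV k + 1) \<and> Q k"
      using par(1)[of "2 * k"] by (intro exI[of _ "2 * k"]) auto
  qed
  show "card (pals (2 * n)) =
      (if \<exists>k\<ge>1. lV (2 * k - 1) < 2 * n \<and> 2 * n \<le> lU (2 * k - 1) then 2 else 1)"
    using card_pals_same_parity[OF par(2), of 0 n] by (simp add: odd del: One_nat_def)
  show "card (pals (2 * n + 1)) =
      (if \<exists>k\<ge>1. lV (2 * k) < 2 * n + 1 \<and> 2 * n + 1 \<le> lU (2 * k) then 3 else 2)"
    using card_pals_same_parity[OF par(2), of 1 n] unfolding even by simp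
qed

text \<open>Even lengths occur at the indices \<open>3 * k - 1\<close>, odd lengths at all
  others.\<close>

lemma card_pals_b_odd_a_even:
  assumes "odd b" "even a"
  shows "card (pals (2 * n)) =
      (if \<exists>k\<ge>1. lV (3 * k - 1) < 2 * n \<and> 2 * n \<le> lU (3 * k - 1) then 2 else 1)"
    and "card (pals (2 * n + 1)) =
      (if \<exists>k\<ge>1. k mod 3 \<noteq> 2 \<and> lV k < 2 * n + 1 \<and> 2 * n + 1 \<le> lU k then 3 else 2)"
proof -
  have par: "even (lV k) \<longleftrightarrow> k mod 3 = 2" "even (lU k) \<longleftrightarrow> even (lV k)" if "1 \<le> k" for k
    using even_length_V_b_odd even_length_U_b_odd assms that by auto
  have two: "(\<exists>k\<ge>1. even (lV k) \<and> Q k) \<longleftrightarrow> (\<exists>k\<ge>1. Q (3 * k - 1))" for Q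
  proof
    assume "\<exists>k\<ge>1. even (lV k) \<and> Q k"
    then obtain k where "k mod 3 = 2" "Q k" using par by blast
    then have "k = 3 * Suc (k div 3) - 1" by presburger
    with \<open>Q k\<close> show "\<exists>k\<ge>1. Q (3 * k - 1)" by (metis le_add1 plus_1_eq_Suc)
  next
    assume "\<exists>k\<ge>1. Q (3 * k - 1)"
    then obtain k where "1 \<le> k" "Q (3 * k - 1)" by blast
    then have "3 * k - 1 = 2 + 3 * (k - 1)" by simp
    then have "(3 * k - 1) mod 3 = 2" by (simp only: mod_mult_self2) simp
    moreover have "1 \<le> 3 * k - 1" using \<open>1 \<le> k\<close> by simp
    ultimately have "1 \<le> 3 * k - 1 \<and> even (lV (3 * k - 1)) \<and> Q (3 * k - 1)"
      using par(1) \<open>Q (3 * k - 1)\<close> by simp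
    then show "\<exists>k\<ge>1. even (lV k) \<and> Q k" by blast
  qed
  show "card (pals (2 * n)) =
      (if \<exists>k\<ge>1. lV (3 * k - 1) < 2 * n \<and> 2 * n \<le> lU (3 * k - 1) then 2 else 1)"
    using card_pals_same_parity[OF par(2), of 0 n] by (simp add: two del: One_nat_def)
  have "(\<exists>k\<ge>1. even (lV k + 1) \<and> Q k) \<longleftrightarrow> (\<exists>k\<ge>1. k mod 3 \<noteq> 2 \<and> Q k)" for Q
    using par by auto
  then show "card (pals (2 * n + 1)) =
      (if \<exists>k\<ge>1. k mod 3 \<noteq> 2 \<and> lV k < 2 * n + 1 \<and> 2 * n + 1 \<le> lU k then 3 else 2)"
    using card_pals_same_parity[OF par(2), of 1 n] by simp
qed

text \<open>\<open>lV k\<close> and \<open>lU k\<close> have opposite parities, so within a parity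
  class a left end at index \<open>k\<close> is closed only by the right end at
  \<open>k + 1\<close>. In the odd class the right end \<open>lU 1\<close> has no left
  partner.\<close>

lemma card_pals_a_even_b_even:
  assumes "even a" "even b"
  shows "card (pals (2 * n)) =
      (if \<exists>k\<ge>1. lV (2 * k - 1) < 2 * n \<and> 2 * n \<le> lU (2 * k) then 2 else 1)"
    and "card (pals (2 * n + 1)) =
      (if 2 * n + 1 \<le> lU 1 \<or>
          (\<exists>k\<ge>1. lV (2 * k) < 2 * n + 1 \<and> 2 * n + 1 \<le> lU (2 * k + 1)) then 2 else 1)"
proof -
  have V: "even (lV k) \<longleftrightarrow> odd k" and U: "even (lU k) \<longleftrightarrow> even k" if "1 \<le> k" for k
    using even_length_V_b_even even_length_U_a_even assms that by auto
  have VU: "lV j < lU k" if "1 \<le> j" "j \<le> k" for j k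
    using length_V_mono[OF that] length_V_less_U[of k] by linarith
  have "card (pals (2 * n + 0)) = 1 + of_bool (\<exists>k. 1 \<le> k \<and>
      int (lV (2 * k - 1)) < int (2 * n + 0) \<and> int (2 * n + 0) \<le> int (lU (2 * k)))"
  proof (rule card_pals_interval)
    fix i :: nat assume i: "even (i + 0)"
    show "(\<exists>k\<ge>1. lU k = i) \<longleftrightarrow> (\<exists>k\<ge>1. int (lU (2 * k)) = int i)" (is "?L \<longleftrightarrow> ?R")
    proof
      assume ?L
      then obtain k where "1 \<le> k" "lU k = i" "even k" using U i by auto
      then show ?R by (auto elim!: evenE)
    next
      assume ?R
      then obtain k where "1 \<le> k" "lU (2 * k) = i" by auto
      then show ?L by (intro exI[of _ "2 * k"]) simp
    qed
    show "(\<exists>k\<ge>1. lV k = i) \<longleftrightarrow> (\<exists>k\<ge>1. int (lV (2 * k - 1)) = int i)" (is "?L \<longleftrightarrow> ?R")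
    proof
      assume ?L
      then obtain k where k: "1 \<le> k" "lV k = i" "odd k" using V i by auto
      then obtain j where "k = 2 * Suc j - 1" by (auto elim!: oddE)
      then show ?R using k by (intro exI[of _ "Suc j"]) auto
    next
      assume ?R
      then obtain k where "1 \<le> k" "lV (2 * k - 1) = i" by auto
      then show ?L by (intro exI[of _ "2 * k - 1"]) simp
    qed
  qed (use V U VU length_U_less_V card_pals_0 in auto)
  then show "card (pals (2 * n)) =
      (if \<exists>k\<ge>1. lV (2 * k - 1) < 2 * n \<and> 2 * n \<le> lU (2 * k) then 2 else 1)"
    unfolding of_nat_less_iff of_nat_le_iff by simp
  \<comment> \<open>The interval ending at \<open>lU 1\<close> gets the artificial left end
    \<open>-1\<close>, which is odd and below every length.\<close>
  let ?l = "\<lambda>k. if k = 0 then - 1 else int (lV (2 * k))"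
  have "card (pals (2 * n + 1)) = 1 + of_bool (\<exists>k. True \<and>
      ?l k < int (2 * n + 1) \<and> int (2 * n + 1) \<le> int (lU (2 * k + 1)))"
  proof (rule card_pals_interval)
    fix i :: nat assume i: "even (i + 1)"
    show "(\<exists>k\<ge>1. lU k = i) \<longleftrightarrow> (\<exists>k. True \<and> int (lU (2 * k + 1)) = int i)" (is "?L \<longleftrightarrow> ?R")
    proof
      assume ?L
      then obtain k where "1 \<le> k" "lU k = i" "odd k" using U i by auto
      then show ?R by (auto elim!: oddE)
    next
      assume ?R
      then obtain k where "lU (2 * k + 1) = i" by auto
      then show ?L by (intro exI[of _ "2 * k + 1"]) simp
    qed
    show "(\<exists>k\<ge>1. lV k = i) \<longleftrightarrow> (\<exists>k. True \<and> ?l k = int i)" (is "?L \<longleftrightarrow> ?R")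
    proof
      assume ?L
      then obtain k where k: "1 \<le> k" "lV k = i" "even k" using V i by auto
      then obtain j where "k = 2 * j" by (auto elim!: evenE)
      then show ?R using k by (intro exI[of _ j]) auto
    next
      assume ?R
      then obtain k where "?l k = int i" by blast
      then have "1 \<le> k" "lV (2 * k) = i" by (auto split: if_splits)
      then show ?L by (intro exI[of _ "2 * k"]) simp
    qed
  next
    \<comment> \<open>Interval 0 already contains 1, which accounts for the second palindrome of
      length 1.\<close>
    show "card (pals 1) = 1 + of_bool (\<exists>k. True \<and>
        ?l k < int 1 \<and> int 1 \<le> int (lU (2 * k + 1)))"
      using b_pos b_less card_pals_1 by (auto intro!: exI[of _ 0] simp: U_word_def)
  qed (use V U VU length_U_less_V in auto)
  moreover have "(\<exists>k. ?l k < int m \<and> int m \<le> int (lU (2 * k + 1))) \<longleftrightarrow>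
      m \<le> lU 1 \<or> (\<exists>k\<ge>1. lV (2 * k) < m \<and> m \<le> lU (2 * k + 1))" (is "?L \<longleftrightarrow> ?R") for m
  proof
    assume ?L
    then obtain k where "?l k < int m" "m \<le> lU (2 * k + 1)" by auto
    then show ?R by (cases "k = 0") auto
  next
    assume ?R
    then show ?L
    proof
      assume "m \<le> lU 1"
      then show ?L by (intro exI[of _ 0]) simp
    next
      assume "\<exists>k\<ge>1. lV (2 * k) < m \<and> m \<le> lU (2 * k + 1)"
      then obtain k where "1 \<le> k" "lV (2 * k) < m" "m \<le> lU (2 * k + 1)" by blast
      then show ?L by (intro exI[of _ k]) simp
    qed
  qed
  ultimately have "card (pals (2 * n + 1)) = 1 + of_bool (2 * n + 1 \<le> lU 1 \<or>
      (\<exists>k\<ge>1. lV (2 * k) < 2 * n + 1 \<and> 2 * n + 1 \<le> lU (2 * k + 1)))"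
    by (simp only: simp_thms)
  then show "card (pals (2 * n + 1)) =
      (if 2 * n + 1 \<le> lU 1 \<or>
          (\<exists>k\<ge>1. lV (2 * k) < 2 * n + 1 \<and> 2 * n + 1 \<le> lU (2 * k + 1)) then 2 else 1)"
    by simp
qed

text \<open>Every length is odd except \<open>lU 1\<close>. Hence the even class has a single drop
  and no rise, while in the odd class the rise after \<open>lV 1\<close> is never undone.\<close>

lemma card_pals_a_odd_b_odd:
  assumes "odd a" "odd b"
  shows "card (pals (2 * n)) = (if 2 * n \<le> lU 1 then 1 else 0)"
    and "card (pals (2 * n + 1)) =
      (if 2 * n + 1 \<le> lV 1 then 2
       else if \<exists>k\<ge>2. lV k < 2 * n + 1 \<and> 2 * n + 1 \<le> lU k then 4 else 3)"
proof -
  have V: "odd (lV k)" for k using odd_length_V_odd assms by blast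
  have U: "even (lU k) \<longleftrightarrow> k = 1" if "1 \<le> k" for k
    using even_length_U_odd assms that by blast
  have even_step: "card (pals (2 * n + 2)) + of_bool (2 * n = lU 1) = card (pals (2 * n))" for n
  proof -
    have "\<not> (\<exists>k\<ge>1. lV k = 2 * n)" using V by (metis dvd_triv_left)
    moreover have "(\<exists>k\<ge>1. lU k = 2 * n) \<longleftrightarrow> 2 * n = lU 1"
      using U by (metis dvd_triv_left order_refl)
    ultimately show ?thesis using card_pals_recurrence[of "2 * n"] by simp
  qed
  show "card (pals (2 * n)) = (if 2 * n \<le> lU 1 then 1 else 0)"
  proof (induction n)
    case (Suc n)
    have "even (lU 1)" using U by simp
    then have "2 * n + 2 \<le> lU 1 \<longleftrightarrow> 2 * n < lU 1" by presburger
    then show ?case using Suc even_step[of n] by (auto split: if_splits)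
  qed (use card_pals_0 in simp)
  have split_one: "(\<exists>k\<ge>1. Q k) \<longleftrightarrow> Q 1 \<or> (\<exists>k\<ge>2. Q k)" for Q :: "nat \<Rightarrow> bool"
  proof -
    have "1 \<le> k \<longleftrightarrow> k = 1 \<or> 2 \<le> k" for k :: nat by auto
    then show ?thesis by (simp only:) blast
  qed
  have V1: "lV 1 < lV k" if "2 \<le> k" for k
    using that by (intro less_trans[OF length_V_less_U length_U_less_V]) auto
  \<comment> \<open>\<open>L\<close> and \<open>A\<close> stand for \<open>lV 1\<close> being below
    or equal to the current length, \<open>B\<close> and \<open>C\<close> for a later
    \<open>lV k\<close> or \<open>lU k\<close> being equal to it. The exclusions turn indicators of
    disjunctions into sums.\<close>
  have shift: "int x' - of_bool (L \<or> A) + of_bool C = int x - of_bool L + of_bool B"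
    if "x' + of_bool C = x + of_bool (A \<or> B)" "\<not> (A \<and> B)" "\<not> (L \<and> A)" for x x' A B C L
    using that by (cases A; cases B; cases C; cases L) auto
  \<comment> \<open>Subtracting the permanent rise at \<open>lV 1\<close> leaves only the paired
    intervals with \<open>k \<ge> 2\<close>, to which \<open>interval_count\<close> applies.\<close>
  let ?f = "\<lambda>n. int (card (pals (2 * n + 1))) - of_bool (lV 1 < 2 * n + 1)"
  have "?f n = 2 + of_bool (\<exists>k. 2 \<le> k \<and> int (lV k) < 1 + 2 * int n \<and> 1 + 2 * int n \<le> int (lU k))"
  proof (rule interval_count[where f = ?f])
    fix n :: nat
    let ?m = "2 * n + 1"
    have "lU 1 \<noteq> ?m" using U[of 1] by auto
    then have "(\<exists>k\<ge>1. lU k = ?m) \<longleftrightarrow> (\<exists>k\<ge>2. lU k = ?m)"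
      unfolding split_one by blast
    then have "card (pals (?m + 2)) + of_bool (\<exists>k\<ge>2. lU k = ?m) =
        card (pals ?m) + of_bool (lV 1 = ?m \<or> (\<exists>k\<ge>2. lV k = ?m))"
      using card_pals_recurrence[of ?m] unfolding split_one[of "\<lambda>k. lV k = ?m"] by (simp only:)
    moreover have "\<not> (lV 1 = ?m \<and> (\<exists>k\<ge>2. lV k = ?m))"
      using V1 by (metis less_irrefl)
    ultimately have step: "int (card (pals (?m + 2))) - of_bool (lV 1 < ?m \<or> lV 1 = ?m) +
        of_bool (\<exists>k\<ge>2. lU k = ?m) =
        int (card (pals ?m)) - of_bool (lV 1 < ?m) + of_bool (\<exists>k\<ge>2. lV k = ?m)"
      by (rule shift) simp
    have eq: "2 * Suc n + 1 = ?m + 2" "1 + 2 * int n = int ?m" by simp_all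
    have "lV 1 < ?m + 2 \<longleftrightarrow> lV 1 < ?m \<or> lV 1 = ?m" using V[of 1] by presburger
    then show "?f (Suc n) + of_bool (\<exists>k\<ge>2. int (lU k) = 1 + 2 * int n) =
        ?f n + of_bool (\<exists>k\<ge>2. int (lV k) = 1 + 2 * int n)"
      unfolding eq of_nat_eq_iff using step by (simp only:)
  next
    fix k :: nat assume "2 \<le> k"
    then show "even (int (lV k) - 1) \<and> even (int (lU k) - 1)"
      using V[of k] U[of k] by simp
  next
    have "\<not> lV k < 1" for k using V[of k] by (cases "lV k") auto
    then show "?f 0 = 2 + of_bool (\<exists>k\<ge>2. int (lV k) < 1 \<and> 1 \<le> int (lU k))"
      using card_pals_1 by auto
  qed (use length_V_less_U length_U_less_V in auto)
  moreover have "1 + 2 * int n = int (2 * n + 1)" by simp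
  ultimately have *: "?f n = 2 + of_bool (\<exists>k\<ge>2. lV k < 2 * n + 1 \<and> 2 * n + 1 \<le> lU k)"
    by (simp only: of_nat_less_iff of_nat_le_iff)
  show "card (pals (2 * n + 1)) =
      (if 2 * n + 1 \<le> lV 1 then 2
       else if \<exists>k\<ge>2. lV k < 2 * n + 1 \<and> 2 * n + 1 \<le> lU k then 4 else 3)"
  proof (cases "2 * n + 1 \<le> lV 1")
    case True
    then have "\<not> (\<exists>k\<ge>2. lV k < 2 * n + 1 \<and> 2 * n + 1 \<le> lU k)"
      using V1 by (meson leD le_less_trans less_imp_le)
    moreover have "\<not> lV 1 < 2 * n + 1" using True by simp
    ultimately have "int (card (pals (2 * n + 1))) - 0 = 2 + 0"
      using * by (simp only: of_bool_eq)
    with True show ?thesis by simp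
  next
    case False
    then have "lV 1 < 2 * n + 1" by simp
    then have "int (card (pals (2 * n + 1))) - 1 =
        2 + of_bool (\<exists>k\<ge>2. lV k < 2 * n + 1 \<and> 2 * n + 1 \<le> lU k)"
      using * by (simp only: of_bool_eq)
    moreover have "x = (if B then 4 else 3)" if "int x - 1 = 2 + of_bool B" for x B
      using that by (cases B) auto
    ultimately show ?thesis unfolding if_not_P[OF False] by blast
  qed
qed

end

theorem theorem5p17:
  fixes a b n :: nat
  assumes "b \<ge> 1" and "a - 1 > b"
  shows
    "(even b \<and> odd a \<longrightarrow>
       pal_complexity (u_beta a b) (2 * n) =
         (if \<exists>k\<ge>1. length (V_word a b (2 * k - 1)) < 2 * n \<and> 2 * n \<le> length (U_word a b (2 * k - 1))
          then 2 else 1) \<and>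
       pal_complexity (u_beta a b) (2 * n + 1) =
         (if \<exists>k\<ge>1. length (V_word a b (2 * k)) < 2 * n + 1 \<and> 2 * n + 1 \<le> length (U_word a b (2 * k))
          then 3 else 2)) \<and>
     (even a \<and> even b \<longrightarrow>
       pal_complexity (u_beta a b) (2 * n) =
         (if \<exists>k\<ge>1. length (V_word a b (2 * k - 1)) < 2 * n \<and> 2 * n \<le> length (U_word a b (2 * k))
          then 2 else 1) \<and>
       pal_complexity (u_beta a b) (2 * n + 1) =
         (if 2 * n + 1 \<le> length (U_word a b 1) \<or>
             (\<exists>k\<ge>1. length (V_word a b (2 * k)) < 2 * n + 1 \<and> 2 * n + 1 \<le> length (U_word a b (2 * k + 1)))
          then 2 else 1)) \<and>
     (odd b \<and> even a \<longrightarrow>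
       pal_complexity (u_beta a b) (2 * n) =
         (if \<exists>k\<ge>1. length (V_word a b (3 * k - 1)) < 2 * n \<and> 2 * n \<le> length (U_word a b (3 * k - 1))
          then 2 else 1) \<and>
       pal_complexity (u_beta a b) (2 * n + 1) =
         (if \<exists>k\<ge>1. k mod 3 \<noteq> 2 \<and>
                length (V_word a b k) < 2 * n + 1 \<and> 2 * n + 1 \<le> length (U_word a b k)
          then 3 else 2)) \<and>
     (odd a \<and> odd b \<longrightarrow>
       pal_complexity (u_beta a b) (2 * n) = (if 2 * n \<le> length (U_word a b 1) then 1 else 0) \<and>
       pal_complexity (u_beta a b) (2 * n + 1) =
         (if 2 * n + 1 \<le> length (V_word a b 1) then 2
          else if \<exists>k\<ge>2. length (V_word a b k) < 2 * n + 1 \<and> 2 * n + 1 \<le> length (U_word a b k) then 4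
          else 3))"
proof -
  interpret beta_subst a b using assms by unfold_locales
  show ?thesis
    unfolding pal_complexity_eq
    using card_pals_b_even_a_odd[of n] card_pals_a_even_b_even[of n]
      card_pals_b_odd_a_even[of n] card_pals_a_odd_b_odd[of n]
    by (intro conjI impI) blast+
qed

end
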